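(* Let $a,b,c,d,S_0,S_1\in\mathbb{Z}$ with $b,d\ge 2$, and assume $\gcd(a,b)=\gcd(c,d)=\gcd(S_0,S_1)=1$ and $\gcd(a,d)=\gcd(b,d)=1$. Let $(S_n)_{n\ge 0}$ be the sequence of rational numbers with initial terms $S_0,S_1$ defined by $$S_{n+2}=\frac{a}{b}S_{n+1}+\frac{c}{d}S_n\qquad (n\ge 0).$$ Then there exists an index $k$ (depending on $a,b,c,d,S_0,S_1$) such that $S_n\notin\mathbb{Z}$ for all $n\ge k$. *)

theory Defs
  imports Complex_Main
begin

end

theory Submission imports Defs "HOL-Computational_Algebra.Primes" begin

text \<open>
  The integers \<open>T n = (b d)^n S n\<close> satisfy \<open>T (n + 2) = A T (n + 1) + B T n\<close> with \<open>A = a d\<close> and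
  \<open>B = b^2 c d\<close>. Let \<open>p\<close> be a prime factor of \<open>b\<close>, so that \<open>p\<close> divides \<open>B\<close> but not \<open>A\<close>. If for
  some \<open>m\<close> the \<open>p\<close>-adic valuation of \<open>T (m + 1)\<close> is smaller than that of \<open>B T m\<close>, the term
  \<open>A T (n + 1)\<close> dominates from then on and the valuation of \<open>T n\<close> is eventually constant, whereas
  integrality of \<open>S n\<close> forces \<open>p^n\<close> to divide \<open>T n\<close>. Otherwise the valuation of \<open>T n\<close> is at least
  \<open>n\<close> times that of \<open>B\<close>; this is too large for the Casoratian \<open>T n T (n + 2) - (T (n + 1))^2\<close>, a
  constant times \<open>(- B)^n\<close>, unless that constant vanishes. Then \<open>S\<close> is a geometric progression of
  ratio \<open>S1 / S0\<close>, and \<open>d\<close> divides \<open>S0^2\<close>, so that \<open>S0\<close> is not a unit.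
\<close>

text \<open>Each step multiplies this Hankel determinant by \<open>- B\<close>, the determinant of
  the companion matrix.\<close>

lemma casoratian_power:
  fixes T :: "nat \<Rightarrow> 'a::comm_ring_1"
  assumes rec: "\<And>n. T (n + 2) = A * T (n + 1) + B * T n"
  shows "T n * T (n + 2) - (T (n + 1))\<^sup>2 = (- B) ^ n * (T 0 * T 2 - (T 1)\<^sup>2)"
proof (induction n)
  case 0
  show ?case by (simp add: numeral_2_eq_2)
next
  case (Suc n)
  have "T (Suc n) * T (Suc n + 2) - (T (Suc n + 1))\<^sup>2
      = - B * (T n * T (n + 2) - (T (n + 1))\<^sup>2)"
    using rec[of n] rec[of "Suc n"] by (simp add: power2_eq_square algebra_simps)
  also have "\<dots> = (- B) ^ Suc n * (T 0 * T 2 - (T 1)\<^sup>2)"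
    by (simp only: Suc.IH power_Suc mult.assoc)
  finally show ?case .
qed

lemma power_not_dvd_persists:
  fixes T :: "nat \<Rightarrow> int"
  assumes rec: "\<And>n. T (n + 2) = A * T (n + 1) + B * T n"
    and p: "prime p" "\<not> p dvd A" "p dvd B"
    and start: "p ^ Suc k dvd B * T m" "p ^ k dvd T (m + 1)" "\<not> p ^ Suc k dvd T (m + 1)"
  shows "\<not> p ^ Suc k dvd T (m + 1 + i)"
proof -
  have cop: "coprime (p ^ Suc k) A"
    using p by (simp add: prime_imp_coprime)
  \<comment> \<open>Invariant: \<open>T (m + i + 1)\<close> has valuation exactly \<open>k\<close>,
    kept because \<open>A\<close> is prime to \<open>p\<close>, and \<open>B\<close> supplies one
    further factor \<open>p\<close>.\<close>
  have "p ^ Suc k dvd B * T (m + i) \<and> p ^ k dvd T (m + i + 1) \<and> \<not> p ^ Suc k dvd T (m + i + 1)"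
  proof (induction i)
    case 0
    show ?case using start by simp
  next
    case (Suc i)
    have step: "T (m + Suc i + 1) = A * T (m + i + 1) + B * T (m + i)"
      using rec[of "m + i"] by simp
    have "p ^ Suc k dvd B * T (m + i + 1)"
      using Suc.IH p(3) by (simp add: mult_dvd_mono)
    moreover have "p ^ k dvd T (m + Suc i + 1)"
      unfolding step using Suc.IH power_le_dvd[of p "Suc k" _ k] by (auto intro: dvd_add)
    moreover have "\<not> p ^ Suc k dvd T (m + Suc i + 1)"
      unfolding step using Suc.IH cop by (metis coprime_dvd_mult_right_iff dvd_add_left_iff)
    ultimately show ?case by simp
  qed
  then show ?thesis by (simp add: add_ac)
qed

lemma eventually_power_not_dvd:
  fixes T :: "nat \<Rightarrow> int"
  assumes rec: "\<And>n. T (n + 2) = A * T (n + 1) + B * T n"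
    and p: "prime p" "\<not> p dvd A" "p dvd B" and "B \<noteq> 0"
    and nondeg: "T 0 * T 2 \<noteq> (T 1)\<^sup>2"
  shows "\<exists>k N. \<forall>n\<ge>N. \<not> p ^ k dvd T n"
proof (cases "\<exists>m k. p ^ Suc k dvd B * T m \<and> p ^ k dvd T (m + 1) \<and> \<not> p ^ Suc k dvd T (m + 1)")
  case True
  then obtain m k where "p ^ Suc k dvd B * T m" "p ^ k dvd T (m + 1)" "\<not> p ^ Suc k dvd T (m + 1)"
    by blast
  from power_not_dvd_persists[OF rec p this] have "\<forall>n\<ge>m + 1. \<not> p ^ Suc k dvd T n"
    by (metis le_Suc_ex)
  then show ?thesis by blast
next
  case False
  \<comment> \<open>In this case the valuation of \<open>T (m + 1)\<close> never stops below that of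
    \<open>B * T m\<close>, so powers of \<open>p\<close> pass on one exponent at a time.\<close>
  have dvd_next: "p ^ k dvd B * T m \<Longrightarrow> p ^ k dvd T (m + 1)" for k m
  proof (induction k)
    case (Suc k)
    then show ?case
      using False power_le_dvd[of p "Suc k" "B * T m" k] by auto
  qed simp
  obtain w B' where B: "B = p ^ w * B'" and B': "\<not> p dvd B'"
    using multiplicity_decompose'[of B p] \<open>B \<noteq> 0\<close> p(1)
    by (metis not_prime_unit)
  have "w > 0"
    using p(3) B B' by (cases w) auto
  have pow_dvd: "p ^ (w * n) dvd T n" for n
  proof (induction n)
    case (Suc n)
    have "p ^ (w * Suc n) dvd B * T n"
      unfolding B using Suc.IH by (simp add: power_add mult_dvd_mono)
    then show ?case using dvd_next by simp
  qed simp
  have pow_dvd': "p ^ (w * n) dvd T i" if "n \<le> i" for n i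
    using pow_dvd[of i] that by (meson dvd_trans le_imp_power_dvd mult_le_mono2)
  define D where "D = T 0 * T 2 - (T 1)\<^sup>2"
  \<comment> \<open>Both Casoratian terms contain \<open>p ^ (2 * w * n)\<close>, but
    \<open>(- B) ^ n\<close> absorbs only \<open>p ^ (w * n)\<close>; the rest must divide
    \<open>D\<close>, for every \<open>n\<close>.\<close>
  have "p ^ n dvd D" for n
  proof -
    have "p ^ (w * n + w * n) dvd T n * T (n + 2)"
      unfolding power_add by (intro mult_dvd_mono pow_dvd') simp_all
    moreover have "p ^ (w * n + w * n) dvd (T (n + 1))\<^sup>2"
      unfolding power_add power2_eq_square by (intro mult_dvd_mono pow_dvd') simp_all
    ultimately have "p ^ (w * n + w * n) dvd (- B) ^ n * D"
      unfolding D_def casoratian_power[OF rec, of n, symmetric] by (rule dvd_diff)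
    also have "(- B) ^ n * D = p ^ (w * n) * ((- B') ^ n * D)"
      unfolding B by (simp add: power_mult flip: power_mult_distrib)
    finally have "p ^ (w * n) dvd (- B') ^ n * D"
      using p(1) by (simp add: power_add)
    moreover have "coprime (p ^ (w * n)) ((- B') ^ n)"
      using p(1) B' by (simp add: prime_imp_coprime)
    ultimately have "p ^ (w * n) dvd D"
      by (simp add: coprime_dvd_mult_right_iff)
    then show ?thesis
      by (rule power_le_dvd) (use \<open>w > 0\<close> in simp)
  qed
  moreover have "finite {n. p ^ n dvd D}"
    using nondeg p(1) by (intro finite_divisor_powers) (auto simp: D_def)
  ultimately have False by simp
  then show ?thesis ..
qed

lemma scaled_recurrence:
  fixes S :: "nat \<Rightarrow> 'a::field_char_0" and a b c d :: int
  assumes "b \<noteq> 0" "d \<noteq> 0"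
    and rec: "\<And>n. S (n + 2) = of_int a / of_int b * S (n + 1) + of_int c / of_int d * S n"
  shows "of_int (b * d) ^ (n + 2) * S (n + 2) =
    of_int (a * d) * (of_int (b * d) ^ (n + 1) * S (n + 1))
      + of_int (b\<^sup>2 * c * d) * (of_int (b * d) ^ n * S n)"
  unfolding rec using assms(1,2) by (simp add: field_simps power2_eq_square)

lemma scaled_in_Ints:
  fixes S :: "nat \<Rightarrow> 'a::field_char_0" and a b c d :: int
  assumes "b \<noteq> 0" "d \<noteq> 0" "S 0 \<in> \<int>" "S 1 \<in> \<int>"
    and rec: "\<And>n. S (n + 2) = of_int a / of_int b * S (n + 1) + of_int c / of_int d * S n"
  shows "of_int (b * d) ^ n * S n \<in> \<int>"
proof (induction n rule: induct_nat_012)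
  case (ge2 n)
  then show ?case
    using scaled_recurrence[OF assms(1,2) rec, of n] by (simp del: of_int_mult)
qed (use assms in auto)

lemma geometric_of_recurrence:
  fixes S :: "nat \<Rightarrow> 'a::field"
  assumes rec: "\<And>n. S (n + 2) = x * S (n + 1) + y * S n"
    and "S 0 \<noteq> 0" and degen: "S 0 * S 2 = (S 1)\<^sup>2"
  shows "S (n + 1) * S 0 ^ n = S 1 ^ (n + 1)"
proof -
  have ratio: "S (n + 1) * S 0 = S n * S 1" for n
  proof (induction n)
    case (Suc n)
    have S2: "S 2 = x * S 1 + y * S 0"
      using rec[of 0] by (simp add: numeral_2_eq_2)
    \<comment> \<open>The extra factor \<open>S 0\<close> makes both the induction hypothesis and
      \<open>degen\<close> applicable; it is cancelled at the end.\<close>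
    have "S (Suc n + 1) * S 0 * S 0 = x * (S (n + 1) * S 0) * S 0 + y * S n * S 0 * S 0"
      using rec[of n] by (simp add: algebra_simps)
    also have "\<dots> = S n * (S 0 * S 2)"
      unfolding Suc.IH S2 by (simp add: algebra_simps)
    also have "\<dots> = (S n * S 1) * S 1"
      by (simp add: degen power2_eq_square)
    also have "\<dots> = S (Suc n) * S 1 * S 0"
      unfolding Suc.IH[symmetric] by simp
    finally show ?case
      using \<open>S 0 \<noteq> 0\<close> by simp
  qed simp
  show ?thesis
  proof (induction n)
    case (Suc n)
    have "S (Suc n + 1) * S 0 ^ Suc n = (S (Suc n + 1) * S 0) * S 0 ^ n"
      by simp
    also have "\<dots> = (S (n + 1) * S 0 ^ n) * S 1"
      using ratio[of "Suc n"] by simp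
    also have "\<dots> = S 1 ^ (Suc n + 1)"
      by (simp add: Suc.IH[simplified])
    finally show ?case .
  qed simp
qed

theorem theorem1p7:
  fixes a b c d S0 S1 :: int and S :: "nat \<Rightarrow> rat"
  assumes "b \<ge> 2" and "d \<ge> 2"
    and "gcd a b = 1" and "gcd c d = 1" and "gcd S0 S1 = 1"
    and "gcd a d = 1" and "gcd b d = 1"
    and "S 0 = of_int S0" and "S 1 = of_int S1"
    and "\<And>n. S (n + 2) = (of_int a / of_int b) * S (n + 1) + (of_int c / of_int d) * S n"
  shows "\<exists>k. \<forall>n\<ge>k. S n \<notin> \<int>"
proof (cases "S 0 * S 2 = (S 1)\<^sup>2")
  case True
  have S2: "S 2 = (of_int a / of_int b) * S 1 + (of_int c / of_int d) * S 0"
    using assms(10)[of 0] by (simp add: numeral_2_eq_2)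
  \<comment> \<open>Otherwise degeneracy forces \<open>S1 = 0\<close> too, against
    \<open>gcd S0 S1 = 1\<close>.\<close>
  have "S0 \<noteq> 0"
    using True assms by auto
  have "of_int (S0 * (a * d * S1 + b * c * S0)) = (of_int (b * d * S1\<^sup>2) :: rat)"
    using True assms(1,2) unfolding S2 assms(8,9) by (simp add: field_simps power2_eq_square)
  then have "S0 * (a * d * S1 + b * c * S0) = b * d * S1\<^sup>2"
    by (simp only: of_int_eq_iff)
  then have "b * c * S0\<^sup>2 = d * (b * S1\<^sup>2 - a * S0 * S1)"
    by (simp add: algebra_simps power2_eq_square)
  then have "d dvd b * c * S0\<^sup>2"
    by simp
  moreover have "coprime d b" "coprime d c"
    using assms(4,7) by (simp_all add: coprime_iff_gcd_eq_1 gcd.commute)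
  then have "coprime d (b * c)"
    by simp
  ultimately have "d dvd S0\<^sup>2"
    by (simp add: coprime_dvd_mult_right_iff)
  \<comment> \<open>From index 2 on, the power of \<open>S0\<close> in the geometric formula has
    positive exponent, so integrality makes \<open>S0\<close> divide a power of
    \<open>S1\<close>.\<close>
  have "S n \<notin> \<int>" if "n \<ge> 2" for n
  proof
    assume "S n \<in> \<int>"
    then obtain z where z: "S n = of_int z"
      by (elim Ints_cases)
    obtain m where n: "n = m + 2"
      using \<open>n \<ge> 2\<close> by (metis add.commute le_Suc_ex)
    have "S (Suc m + 1) * S 0 ^ Suc m = S 1 ^ (Suc m + 1)"
      by (rule geometric_of_recurrence[OF assms(10) _ True]) (simp add: \<open>S0 \<noteq> 0\<close> assms(8))
    then have "of_int (z * S0 ^ Suc m) = (of_int (S1 ^ (Suc m + 1)) :: rat)"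
      using z by (simp add: n assms(8) assms(9)[simplified])
    then have "z * S0 ^ Suc m = S1 ^ (Suc m + 1)"
      by (simp only: of_int_eq_iff)
    then have "S0 dvd S1 ^ (Suc m + 1)"
      by (metis dvd_mult dvd_triv_left power_Suc)
    moreover have "coprime S0 S1"
      using assms(5) by (simp add: coprime_iff_gcd_eq_1)
    then have "coprime S0 (S1 ^ (Suc m + 1))"
      by simp
    ultimately have "is_unit S0"
      using coprime_absorb_left by blast
    then have "is_unit (S0\<^sup>2)"
      by (simp only: is_unit_power_iff simp_thms)
    with \<open>d dvd S0\<^sup>2\<close> have "is_unit d"
      by (rule dvd_trans)
    then show False
      using \<open>d \<ge> 2\<close> by simp
  qed
  then show ?thesis by blast
next
  case False
  \<comment> \<open>The floor only moves the values to type \<open>int\<close>; the scaled terms are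
    already integers.\<close>
  define T where "T n = \<lfloor>of_int (b * d) ^ n * S n\<rfloor>" for n
  have T: "of_int (T n) = of_int (b * d) ^ n * S n" for n
  proof -
    have "of_int (b * d) ^ n * S n \<in> \<int>"
      by (rule scaled_in_Ints[OF _ _ _ _ assms(10)]) (use assms(1,2,8,9) in auto)
    then show ?thesis
      by (auto simp: T_def elim: Ints_cases)
  qed
  have rec: "T (n + 2) = (a * d) * T (n + 1) + (b\<^sup>2 * c * d) * T n" for n
  proof -
    have "(of_int (T (n + 2)) :: rat) = of_int ((a * d) * T (n + 1) + (b\<^sup>2 * c * d) * T n)"
      unfolding of_int_add of_int_mult[of _ "T _"] T
      by (rule scaled_recurrence) (use assms(1,2,10) in auto)
    then show ?thesis by (simp only: of_int_eq_iff)
  qed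
  obtain p where p: "prime p" "p dvd b"
    using assms(1) prime_divisor_exists[of b] by auto
  have "\<not> p dvd a * d"
  proof
    assume "p dvd a * d"
    then have "p dvd gcd a b \<or> p dvd gcd b d"
      using p by (auto simp: prime_dvd_mult_iff)
    then show False
      using assms(3,7) p(1) by auto
  qed
  moreover have "p dvd b\<^sup>2 * c * d"
    using p(2) by (simp add: power2_eq_square)
  \<comment> \<open>Here \<open>c = 0\<close> would give \<open>gcd c d = d \<ge> 2\<close>.\<close>
  moreover have "b\<^sup>2 * c * d \<noteq> 0"
    using assms(1,2,4) by auto
  moreover have "T 0 * T 2 \<noteq> (T 1)\<^sup>2"
  proof
    assume "T 0 * T 2 = (T 1)\<^sup>2"
    then have "of_int (T 0) * of_int (T 2) = (of_int (T 1) :: rat)\<^sup>2"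
      by (metis of_int_mult of_int_power)
    \<comment> \<open>Both sides carry the same scaling factor \<open>(b * d)^2\<close>.\<close>
    then have "S 0 * S 2 = (S 1)\<^sup>2"
      using assms(1,2) unfolding T by (simp add: power_mult_distrib)
    then show False
      using False by simp
  qed
  ultimately obtain k N where kN: "\<And>n. n \<ge> N \<Longrightarrow> \<not> p ^ k dvd T n"
    using eventually_power_not_dvd[OF rec p(1)] by blast
  \<comment> \<open>The bound \<open>k\<close> puts \<open>p ^ k\<close> into
    \<open>(b * d) ^ n\<close>, while \<open>N\<close> keeps it out of \<open>T n\<close>.\<close>
  have "S n \<notin> \<int>" if n: "n \<ge> max k N" for n
  proof
    assume "S n \<in> \<int>"
    then obtain z where "S n = of_int z"
      by (elim Ints_cases)
    then have "(of_int (T n) :: rat) = of_int ((b * d) ^ n * z)"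
      unfolding T by simp
    then have "T n = (b * d) ^ n * z"
      by (simp only: of_int_eq_iff)
    moreover have "p ^ k dvd (b * d) ^ n"
      using n p(2) by (intro dvd_power_le) auto
    ultimately show False
      using kN[of n] n by simp
  qed
  then show ?thesis by blast
qed

end
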